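(* Let $P=\{p_1,\dots,p_n\}$, $n\ge1$, be a finite partially ordered set and let $H_P\subset S=K[x_1,\dots,x_n,y_1,\dots,y_n]$ be the Hibi ideal of $P$, $K$ a field. Then $$\mathrm{v}(H_P^k)=k|P|-1\quad\text{for all } k\ge1.$$
   Context: A poset ideal of $(P,\preceq)$ is a subset $\mathcal I\subseteq P$ such that $p_i\in P$, $p_j\in\mathcal I$ and $p_i\preceq p_j$ imply $p_i\in\mathcal I$. To a poset ideal $\mathcal I$ (possibly empty or all of $P$) associate the monomial $u_{\mathcal I}=\left(\prod_{p_i\in\mathcal I}x_i\right)\left(\prod_{p_i\in P\setminus\mathcal I}y_i\right)$. The Hibi ideal $H_P$ is the ideal of $S$ generated by all $u_{\mathcal I}$, where $\mathcal I$ ranges over all poset ideals of $P$. $S=\bigoplus_d S_d$ is standard graded. For a graded ideal $I\subset S$, $\mathrm{Ass}(I)$ is the set of associated primes of $S/I$ and $\mathrm{v}(I)=\min\{d: \exists f\in S_d\text{ with } (I:f)\in\mathrm{Ass}(I)\}$. *)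

theory Defs
  imports
    "HOL-Library.Poly_Mapping"
    "HOL-Library.Extended_Nat"
    "HOL-Library.Cardinality"
    "HOL-Algebra.Ideal_Product"
    "HOL-Algebra.QuotRing"
    "HOL-Algebra.Algebraic_Closure_Type"
begin

text \<open>Exponent vectors are finitely supported maps \<open>'v \<Rightarrow>\<^sub>0 nat\<close>, so the type below is the
  polynomial ring \<open>K[x\<^sub>v : v \<in> 'v]\<close>; with \<open>poly_ring\<close> it is also an \<open>HOL-Algebra\<close> ring.\<close>

type_synonym ('v, 'k) mpoly = "('v \<Rightarrow>\<^sub>0 nat) \<Rightarrow>\<^sub>0 'k"

abbreviation poly_ring :: "('v, 'k::field) mpoly ring"
  where "poly_ring \<equiv> ring_of_type_algebra"

definition var :: "'v \<Rightarrow> ('v, 'k::field) mpoly"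
  where "var v = Poly_Mapping.single (Poly_Mapping.single v 1) 1"

definition monom_deg :: "('v \<Rightarrow>\<^sub>0 nat) \<Rightarrow> nat"
  where "monom_deg m = (\<Sum>v\<in>Poly_Mapping.keys m. Poly_Mapping.lookup m v)"

definition graded_part :: "nat \<Rightarrow> ('v, 'k::field) mpoly set"
  where "graded_part d = {f. \<forall>m\<in>Poly_Mapping.keys f. monom_deg m = d}"

definition colon_ideal :: "('a, 'b) ring_scheme \<Rightarrow> 'a set \<Rightarrow> 'a \<Rightarrow> 'a set"
  where "colon_ideal R I f = {s \<in> carrier R. s \<otimes>\<^bsub>R\<^esub> f \<in> I}"

text \<open>The annihilator in \<open>R\<close> of an element \<open>m\<close> of the \<open>R\<close>-module \<open>R/I\<close>, on which \<open>s\<close> acts as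
  multiplication by its residue class.\<close>

definition quot_annihilator :: "('a, 'b) ring_scheme \<Rightarrow> 'a set \<Rightarrow> 'a set \<Rightarrow> 'a set"
  where "quot_annihilator R I m =
    {s \<in> carrier R. (I +>\<^bsub>R\<^esub> s) \<otimes>\<^bsub>R Quot I\<^esub> m = \<zero>\<^bsub>R Quot I\<^esub>}"

definition associated_primes :: "('a, 'b) ring_scheme \<Rightarrow> 'a set \<Rightarrow> 'a set set"
  where "associated_primes R I =
    {p. primeideal p R \<and> (\<exists>m\<in>carrier (R Quot I). p = quot_annihilator R I m)}"

text \<open>The values are in \<open>enat\<close> so that a finite value is always an attained minimum: the
  infimum of the empty set is \<open>\<infinity>\<close>.\<close>

definition v_number :: "('v, 'k::field) mpoly set \<Rightarrow> enat"
  where "v_number I =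
    Inf {enat d |d. \<exists>f\<in>graded_part d. colon_ideal poly_ring I f \<in> associated_primes poly_ring I}"

definition poset_ideal :: "'p::order set \<Rightarrow> bool"
  where "poset_ideal I \<longleftrightarrow> (\<forall>p q. q \<in> I \<longrightarrow> p \<le> q \<longrightarrow> p \<in> I)"

text \<open>The poset \<open>P\<close> is the whole finite type \<open>'p\<close>; \<open>Inl p\<close> indexes the variable \<open>x\<^sub>p\<close> and
  \<open>Inr p\<close> the variable \<open>y\<^sub>p\<close>.\<close>

definition ideal_monomial :: "'p::{finite,order} set \<Rightarrow> ('p + 'p, 'k::field) mpoly"
  where "ideal_monomial I = (\<Prod>p\<in>I. var (Inl p)) * (\<Prod>p\<in>UNIV - I. var (Inr p))"

definition hibi_ideal :: "('p::{finite,order} + 'p, 'k::field) mpoly set"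
  where "hibi_ideal = Idl\<^bsub>poly_ring\<^esub> {ideal_monomial I |I. poset_ideal I}"

text \<open>The powers are taken in the semiring \<open>ideals_set\<close> of ideals, whose multiplication is the
  product of ideals.\<close>

definition ideal_power :: "('v, 'k::field) mpoly set \<Rightarrow> nat \<Rightarrow> ('v, 'k) mpoly set"
  where "ideal_power I k = I [^]\<^bsub>ideals_set poly_ring\<^esub> k"

end

theory Submission
  imports Defs
begin

text \<open>Write \<open>H\<close> for the Hibi ideal and \<open>n\<close> for the size of the poset. Every generator of \<open>H\<close> has degree
  \<open>n\<close>, and it is divisible by exactly one of \<open>x\<^sub>p\<close> and \<open>y\<^sub>p\<close> for each \<open>p\<close>. Hence all terms of an element
  of \<open>H\<^sup>k\<close> have degree at least \<open>k n\<close>, and joint degree at least \<open>k\<close> in \<open>x\<^sub>p\<close> and \<open>y\<^sub>p\<close>; both facts are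
  instances of \<open>ideal_power_weight_ge\<close>.

  Lower bound (\<open>hibi_power_colon_prime_degree\<close>): if \<open>f\<close> is homogeneous and \<open>(H\<^sup>k : f)\<close> is prime, then
  this prime contains \<open>H\<^sup>k\<close>, which contains a product of variables, so it contains a variable \<open>z\<close>. The
  nonzero form \<open>z f\<close> lies in \<open>H\<^sup>k\<close>, and therefore \<open>deg f + 1 \<ge> k n\<close>.

  Upper bound (\<open>hibi_power_colon_witness\<close>): let \<open>p\<close> be a minimal element and let \<open>u\<close> be the product of
  all the variables \<open>y\<^sub>q\<close>, which is the generator of the empty poset ideal. The monomial
  \<open>f = u\<^sup>k / y\<^sub>p\<close> has degree \<open>k n - 1\<close>. Both \<open>y\<^sub>p f = u\<^sup>k\<close> and \<open>x\<^sub>p f = u' u\<^sup>k / u\<close> lie in \<open>H\<^sup>k\<close>, where \<open>u'\<close> is the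
  generator of the poset ideal \<open>{p}\<close>. Since \<open>f\<close> has joint degree only \<open>k - 1\<close> in \<open>x\<^sub>p\<close> and \<open>y\<^sub>p\<close>, an
  \<open>s\<close> with \<open>s f\<close> in \<open>H\<^sup>k\<close> has all its terms divisible by \<open>x\<^sub>p\<close> or \<open>y\<^sub>p\<close>. So \<open>(H\<^sup>k : f) = (x\<^sub>p, y\<^sub>p)\<close>,
  a prime ideal (\<open>primeideal_weight_ge_1\<close>).\<close>

section \<open>Polynomial rings as abstract rings\<close>

lemma poly_ring_simps [simp]:
  "carrier poly_ring = UNIV"
  "monoid.mult poly_ring = (*)"
  "monoid.one poly_ring = 1"
  "ring.zero poly_ring = 0"
  "ring.add poly_ring = (+)"
  by (simp_all add: ring_of_type_algebra_def)

lemma cring_poly_ring: "cring (poly_ring :: ('v, 'k::field) mpoly ring)"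
  by (rule cring_from_type_algebra)

lemma ring_poly_ring: "ring (poly_ring :: ('v, 'k::field) mpoly ring)"
  by (rule ring_from_type_algebra)

lemma a_inv_poly_ring [simp]:
  fixes f :: "('v, 'k::field) mpoly"
  shows "a_inv poly_ring f = - f"
proof -
  interpret ring "poly_ring :: ('v, 'k) mpoly ring"
    by (rule ring_poly_ring)
  show ?thesis
    using minus_equality[of "- f" f] by simp
qed

lemma poly_ideal_iff:
  fixes I :: "('v, 'k::field) mpoly set"
  shows "ideal I poly_ring \<longleftrightarrow>
    0 \<in> I \<and> (\<forall>f\<in>I. \<forall>g\<in>I. f + g \<in> I) \<and> (\<forall>f\<in>I. \<forall>s. s * f \<in> I)"
proof
  assume "ideal I poly_ring"
  then interpret ideal I "poly_ring :: ('v, 'k) mpoly ring" .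
  show "0 \<in> I \<and> (\<forall>f\<in>I. \<forall>g\<in>I. f + g \<in> I) \<and> (\<forall>f\<in>I. \<forall>s. s * f \<in> I)"
    using additive_subgroup.zero_closed[OF is_additive_subgroup]
      additive_subgroup.a_closed[OF is_additive_subgroup] I_l_closed by simp
next
  assume I: "0 \<in> I \<and> (\<forall>f\<in>I. \<forall>g\<in>I. f + g \<in> I) \<and> (\<forall>f\<in>I. \<forall>s. s * f \<in> I)"
  interpret ring "poly_ring :: ('v, 'k) mpoly ring"
    by (rule ring_poly_ring)
  have neg: "- f \<in> I" if "f \<in> I" for f
    using I that mult_minus1[of f] by metis
  show "ideal I poly_ring"
  proof (rule idealI)
    show "ring (poly_ring :: ('v, 'k) mpoly ring)" by (rule ring_poly_ring)
    show "subgroup I (add_monoid poly_ring)"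
    proof (rule subgroup.intro)
      show "inv\<^bsub>add_monoid poly_ring\<^esub> f \<in> I" if "f \<in> I" for f
        using neg[OF that] a_inv_poly_ring[of f] by (simp only: a_inv_def)
    qed (use I in auto)
    show "x \<otimes>\<^bsub>poly_ring\<^esub> a \<in> I" if "a \<in> I" for a x
      using I that by simp
    show "a \<otimes>\<^bsub>poly_ring\<^esub> x \<in> I" if "a \<in> I" for a x
      using I that by (simp add: mult.commute)
  qed
qed

lemma poly_mapping_eq_sum_terms:
  "f = (\<Sum>m\<in>Poly_Mapping.keys f. Poly_Mapping.single m (Poly_Mapping.lookup f m))"
  by (rule poly_mapping_eqI) (simp add: lookup_sum lookup_single when_def in_keys_iff)

lemma poly_ideal_sum:
  fixes I :: "('v, 'k::field) mpoly set"
  assumes "ideal I poly_ring" "\<And>a. a \<in> A \<Longrightarrow> f a \<in> I"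
  shows "sum f A \<in> I"
  using assms(2) assms(1)
  by (induction A rule: infinite_finite_induct) (auto simp: poly_ideal_iff)

lemma colon_ideal_poly_ring: "colon_ideal poly_ring I f = {s. s * f \<in> I}"
  by (simp add: colon_ideal_def)

lemma quot_annihilator_residue:
  fixes I :: "('v, 'k::field) mpoly set"
  assumes "ideal I poly_ring"
  shows "quot_annihilator poly_ring I (I +>\<^bsub>poly_ring\<^esub> f) = colon_ideal poly_ring I f"
proof -
  interpret ideal I "poly_ring :: ('v, 'k) mpoly ring" by fact
  have "I +>\<^bsub>poly_ring\<^esub> g = I \<longleftrightarrow> g \<in> I" for g :: "('v, 'k) mpoly"
    using a_rcos_const[of g] a_rcos_self[of g] by auto
  moreover have "rcoset_mult poly_ring I (I +>\<^bsub>poly_ring\<^esub> s) (I +>\<^bsub>poly_ring\<^esub> f)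
      = I +>\<^bsub>poly_ring\<^esub> (s * f)" for s
    using rcoset_mult_add[of s f] by simp
  ultimately show ?thesis
    by (simp add: quot_annihilator_def colon_ideal_def FactRing_def)
qed

text \<open>A colon ideal \<open>(I : f)\<close> is the annihilator of the residue class of \<open>f\<close>, so it is an associated
  prime as soon as it is prime.\<close>

lemma colon_ideal_in_associated_primes_iff:
  fixes I :: "('v, 'k::field) mpoly set"
  assumes "ideal I poly_ring"
  shows "colon_ideal poly_ring I f \<in> associated_primes poly_ring I \<longleftrightarrow>
    primeideal (colon_ideal poly_ring I f) poly_ring"
proof -
  interpret ideal I "poly_ring :: ('v, 'k) mpoly ring" by fact
  have "I +>\<^bsub>poly_ring\<^esub> f \<in> carrier (poly_ring Quot I)"
    using a_rcosetsI[OF a_subset, of f] by (simp add: FactRing_def)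
  then show ?thesis
    unfolding associated_primes_def
    using quot_annihilator_residue[OF assms, of f] by auto
qed

lemma prime_ideal_prod:
  fixes p :: "('v, 'k::field) mpoly set"
  assumes "primeideal p poly_ring" "finite A" "prod f A \<in> p"
  shows "\<exists>a\<in>A. f a \<in> p"
  using assms(2,3)
proof (induction A)
  case empty
  interpret primeideal p "poly_ring :: ('v, 'k) mpoly ring" by fact
  show ?case
    using empty I_notcarr one_imp_carrier by simp
next
  case (insert a A)
  interpret primeideal p "poly_ring :: ('v, 'k) mpoly ring" by fact
  show ?case
    using insert I_prime[of "f a" "prod f A"] by auto
qed

section \<open>Unique products of monomials\<close>

lemma lookup_mult_unique:
  fixes f g :: "('v, 'k::field) mpoly"
  assumes "\<And>u' v'. u' \<in> Poly_Mapping.keys f \<Longrightarrow> v' \<in> Poly_Mapping.keys g \<Longrightarrow>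
    u' + v' = u + v \<Longrightarrow> u' = u"
  shows "Poly_Mapping.lookup (f * g) (u + v)
    = Poly_Mapping.lookup f u * Poly_Mapping.lookup g v"
proof -
  have "Poly_Mapping.lookup f l * (\<Sum>q. Poly_Mapping.lookup g q when u + v = l + q)
      = (Poly_Mapping.lookup f l * Poly_Mapping.lookup g v when l = u)" for l
  proof (cases "l = u \<or> l \<notin> Poly_Mapping.keys f")
    case True
    then show ?thesis
      by (auto simp: in_keys_iff when_def)
  next
    case False
    then have "(Poly_Mapping.lookup g q when u + v = l + q) = 0" for q
      using assms[of l q] by (cases "Poly_Mapping.lookup g q = 0") (auto simp: in_keys_iff when_def)
    then show ?thesis
      using False by simp
  qed
  then show ?thesis
    by (simp add: lookup_mult)
qed

lemma keys_mult_monomial: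
  fixes f :: "('v, 'k::field) mpoly"
  assumes "m \<in> Poly_Mapping.keys f"
  shows "m + a \<in> Poly_Mapping.keys (f * Poly_Mapping.single a 1)"
  using assms lookup_mult_unique[of f "Poly_Mapping.single a 1" m a]
  by (simp add: in_keys_iff lookup_single)

text \<open>The variables carry no order, so they are numbered. The ordered cancellative monoid of finitely
  supported maps on \<open>nat\<close> then provides a monomial order, by pullback along this embedding.\<close>

lemma monomial_embedding_exists:
  "\<exists>e :: ('v::finite \<Rightarrow>\<^sub>0 nat) \<Rightarrow> (nat \<Rightarrow>\<^sub>0 nat). inj e \<and> (\<forall>a b. e (a + b) = e a + e b)"
proof -
  obtain \<nu> :: "'v \<Rightarrow> nat" where \<nu>: "inj \<nu>"
    using finite_imp_inj_to_nat_seg[of "UNIV :: 'v set"] by auto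
  define e where
    "e m = (\<Sum>v\<in>UNIV. Poly_Mapping.single (\<nu> v) (Poly_Mapping.lookup m v))" for m :: "'v \<Rightarrow>\<^sub>0 nat"
  have "Poly_Mapping.lookup (e m) (\<nu> v) = Poly_Mapping.lookup m v" for m v
    using inj_eq[OF \<nu>] by (simp add: e_def lookup_sum lookup_single when_def)
  then have "inj e"
    by (intro injI poly_mapping_eqI) metis
  moreover have "e (a + b) = e a + e b" for a b
    by (simp add: e_def lookup_add single_add sum.distrib)
  ultimately show ?thesis by blast
qed

text \<open>The product of the largest elements of \<open>A\<close> and \<open>B\<close>, for a monomial order, arises in no other way.\<close>

lemma unique_product:
  fixes A B :: "('v::finite \<Rightarrow>\<^sub>0 nat) set"
  assumes "finite A" "A \<noteq> {}" "finite B" "B \<noteq> {}"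
  obtains u v where "u \<in> A" "v \<in> B"
    "\<And>u' v'. u' \<in> A \<Longrightarrow> v' \<in> B \<Longrightarrow> u' + v' = u + v \<Longrightarrow> u' = u"
proof -
  obtain e :: "('v \<Rightarrow>\<^sub>0 nat) \<Rightarrow> (nat \<Rightarrow>\<^sub>0 nat)"
    where e: "inj e" "\<And>a b. e (a + b) = e a + e b"
    using monomial_embedding_exists by blast
  have max: "\<exists>c\<in>C. \<forall>c'\<in>C. e c' \<le> e c" if "finite C" "C \<noteq> {}" for C
  proof -
    have "Max (e ` C) \<in> e ` C"
      using that by (intro Max_in) auto
    then obtain c where "c \<in> C" "e c = Max (e ` C)"
      by auto
    then show ?thesis
      using that by (auto intro!: bexI[of _ c])
  qed
  obtain u v where uv: "u \<in> A" "\<And>u'. u' \<in> A \<Longrightarrow> e u' \<le> e u"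
      "v \<in> B" "\<And>v'. v' \<in> B \<Longrightarrow> e v' \<le> e v"
    using max[OF assms(1,2)] max[OF assms(3,4)] by blast
  have "u' = u" if "u' \<in> A" "v' \<in> B" "u' + v' = u + v" for u' v'
  proof -
    have "e u' + e v' = e u + e v"
      using that e(2) by metis
    moreover have "e u' + e v' \<le> e u' + e v"
      using uv(4)[OF that(2)] by (rule add_left_mono)
    ultimately have "e u \<le> e u'"
      by simp
    then show ?thesis
      using uv(2)[OF that(1)] e(1) by (simp add: inj_eq)
  qed
  then show thesis
    using that uv by blast
qed

section \<open>Additive weights of monomials\<close>

text \<open>The polynomials all of whose terms have weight at least \<open>d\<close>; the weights \<open>w\<close> considered
  below are additive.\<close>

definition weight_ge :: "(('v \<Rightarrow>\<^sub>0 nat) \<Rightarrow> nat) \<Rightarrow> nat \<Rightarrow> ('v, 'k::field) mpoly set"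
  where "weight_ge w d = {f. \<forall>m\<in>Poly_Mapping.keys f. d \<le> w m}"

lemma weight_ge_add: "f \<in> weight_ge w d \<Longrightarrow> g \<in> weight_ge w d \<Longrightarrow> f + g \<in> weight_ge w d"
  unfolding weight_ge_def using keys_add[of f g] by blast

lemma weight_ge_mult:
  assumes "\<And>a b. w (a + b) = w a + w b" "f \<in> weight_ge w c" "g \<in> weight_ge w d"
  shows "f * g \<in> weight_ge w (c + d)"
  unfolding weight_ge_def
proof safe
  fix m assume "m \<in> Poly_Mapping.keys (f * g)"
  then obtain a b where "m = a + b" "a \<in> Poly_Mapping.keys f" "b \<in> Poly_Mapping.keys g"
    using keys_mult[of f g] by blast
  then show "c + d \<le> w m"
    using assms by (simp add: weight_ge_def add_mono)
qed

lemma weight_ge_0 [simp]: "weight_ge w 0 = UNIV"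
  by (simp add: weight_ge_def)

lemma ideal_weight_ge:
  assumes "\<And>a b. w (a + b) = w a + w b"
  shows "ideal (weight_ge w d :: ('v, 'k::field) mpoly set) poly_ring"
  unfolding poly_ideal_iff
proof (intro conjI ballI allI)
  show "s * f \<in> weight_ge w d" if "f \<in> weight_ge w d" for f s :: "('v, 'k) mpoly"
    using weight_ge_mult[OF assms _ that, of s 0] by simp
qed (simp_all add: weight_ge_add, simp add: weight_ge_def)

text \<open>If two polynomials have a term of weight \<open>0\<close>, so does their product: take a unique product among
  their terms of weight \<open>0\<close>; terms of positive weight do not contribute to its coefficient.\<close>

lemma primeideal_weight_ge_1:
  fixes w :: "('v::finite \<Rightarrow>\<^sub>0 nat) \<Rightarrow> nat"
  assumes add: "\<And>a b. w (a + b) = w a + w b"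
  shows "primeideal (weight_ge w 1 :: ('v, 'k::field) mpoly set) poly_ring"
proof (rule primeidealI)
  show "ideal (weight_ge w 1 :: ('v, 'k) mpoly set) poly_ring"
    by (rule ideal_weight_ge[OF add])
  show "cring (poly_ring :: ('v, 'k) mpoly ring)"
    by (rule cring_poly_ring)
  have "w 0 = 0"
    using add[of 0 0] by simp
  then have "1 \<notin> (weight_ge w 1 :: ('v, 'k) mpoly set)"
    by (simp add: weight_ge_def)
  then show "carrier poly_ring \<noteq> (weight_ge w 1 :: ('v, 'k) mpoly set)"
    by auto
next
  fix f g :: "('v, 'k) mpoly"
  assume fg: "f \<otimes>\<^bsub>poly_ring\<^esub> g \<in> weight_ge w 1"
  define A where "A = {m \<in> Poly_Mapping.keys f. w m = 0}"
  define B where "B = {m \<in> Poly_Mapping.keys g. w m = 0}"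
  show "f \<in> weight_ge w 1 \<or> g \<in> weight_ge w 1"
  proof (rule ccontr)
    assume "\<not> (f \<in> weight_ge w 1 \<or> g \<in> weight_ge w 1)"
    then have "A \<noteq> {}" "B \<noteq> {}"
      by (auto simp: A_def B_def weight_ge_def not_le)
    moreover have "finite A" "finite B"
      by (simp_all add: A_def B_def)
    ultimately obtain u v where uv: "u \<in> A" "v \<in> B"
        and unique: "\<And>u' v'. u' \<in> A \<Longrightarrow> v' \<in> B \<Longrightarrow> u' + v' = u + v \<Longrightarrow> u' = u"
      by (metis unique_product)
    have w0: "w (u + v) = 0"
      using uv by (simp add: add A_def B_def)
    have "u' = u" if "u' \<in> Poly_Mapping.keys f" "v' \<in> Poly_Mapping.keys g" "u' + v' = u + v" for u' v'
    proof -
      have "w u' + w v' = 0"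
        using w0 that(3) add by metis
      then show ?thesis
        using that by (intro unique[of u' v']) (simp_all add: A_def B_def)
    qed
    then have "Poly_Mapping.lookup (f * g) (u + v)
        = Poly_Mapping.lookup f u * Poly_Mapping.lookup g v"
      by (rule lookup_mult_unique)
    then have "u + v \<in> Poly_Mapping.keys (f * g)"
      using uv by (simp add: A_def B_def in_keys_iff)
    then show False
      using fg w0 by (auto simp: weight_ge_def)
  qed
qed

lemma weight_sum:
  fixes w :: "('v \<Rightarrow>\<^sub>0 nat) \<Rightarrow> nat"
  assumes "\<And>a b. w (a + b) = w a + w b"
  shows "w (sum f A) = (\<Sum>a\<in>A. w (f a))"
proof -
  have "w 0 = 0"
    using assms[of 0 0] by simp
  then show ?thesis
    by (induction A rule: infinite_finite_induct) (simp_all add: assms)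
qed

lemma monom_deg_eq_sum:
  assumes "finite V" "Poly_Mapping.keys m \<subseteq> V"
  shows "monom_deg m = (\<Sum>v\<in>V. Poly_Mapping.lookup m v)"
  unfolding monom_deg_def
  by (rule sum.mono_neutral_left) (use assms in \<open>auto simp: in_keys_iff\<close>)

lemma monom_deg_add: "monom_deg (a + b) = monom_deg a + monom_deg b"
proof -
  let ?V = "Poly_Mapping.keys a \<union> Poly_Mapping.keys b"
  have "monom_deg (a + b) = (\<Sum>v\<in>?V. Poly_Mapping.lookup (a + b) v)"
    by (rule monom_deg_eq_sum) (use keys_add[of a b] in auto)
  also have "\<dots> = (\<Sum>v\<in>?V. Poly_Mapping.lookup a v) + (\<Sum>v\<in>?V. Poly_Mapping.lookup b v)"
    by (simp add: lookup_add sum.distrib)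
  also have "\<dots> = monom_deg a + monom_deg b"
    by (simp add: monom_deg_eq_sum[of ?V])
  finally show ?thesis .
qed

lemma monom_deg_single [simp]: "monom_deg (Poly_Mapping.single v n) = n"
  by (simp add: monom_deg_def)

text \<open>The joint degree in the two variables \<open>x\<^sub>p\<close> and \<open>y\<^sub>p\<close> attached to \<open>p\<close>.\<close>

definition pair_deg :: "'p \<Rightarrow> (('p + 'p) \<Rightarrow>\<^sub>0 nat) \<Rightarrow> nat"
  where "pair_deg p m = Poly_Mapping.lookup m (Inl p) + Poly_Mapping.lookup m (Inr p)"

lemma pair_deg_add: "pair_deg p (a + b) = pair_deg p a + pair_deg p b"
  by (simp add: pair_deg_def lookup_add)

lemma pair_deg_single [simp]:
  "pair_deg p (Poly_Mapping.single (Inl q) (Suc 0)) = (if q = p then 1 else 0)"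
  "pair_deg p (Poly_Mapping.single (Inr q) (Suc 0)) = (if q = p then 1 else 0)"
  by (auto simp: pair_deg_def lookup_single when_def)

lemma prod_var:
  "(\<Prod>a\<in>A. var (g a)) = (Poly_Mapping.single (\<Sum>a\<in>A. Poly_Mapping.single (g a) 1) 1
    :: ('v, 'k::field) mpoly)"
  by (induction A rule: infinite_finite_induct) (simp_all add: var_def mult_single)

lemma monomial_power:
  "(Poly_Mapping.single a 1 :: ('v, 'k::field) mpoly) ^ n = Poly_Mapping.single (\<Sum>i<n. a) 1"
  by (induction n) (simp_all add: mult_single add.commute)

section \<open>Powers of the Hibi ideal\<close>

lemma ideal_power_0: "ideal_power I 0 = UNIV"
  by (simp add: ideal_power_def ideals_set_def nat_pow_def)

lemma ideal_power_Suc: "ideal_power I (Suc k) = ideal_prod poly_ring (ideal_power I k) I"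
  by (simp add: ideal_power_def ideals_set_def nat_pow_def)

lemma ideal_ideal_power:
  assumes "ideal I (poly_ring :: ('v, 'k::field) mpoly ring)"
  shows "ideal (ideal_power I k) poly_ring"
proof (induction k)
  case 0
  then show ?case
    by (simp add: ideal_power_0 poly_ideal_iff)
next
  case (Suc k)
  then show ?case
    using ring.ideal_prod_is_ideal[OF ring_poly_ring _ assms] by (simp add: ideal_power_Suc)
qed

lemma mult_in_ideal_power_Suc:
  "f \<in> ideal_power I k \<Longrightarrow> g \<in> I \<Longrightarrow> f * g \<in> ideal_power I (Suc k)"
  unfolding ideal_power_Suc using ideal_prod.prod[of f "ideal_power I k" g I poly_ring] by simp

lemma power_in_ideal_power: "f \<in> I \<Longrightarrow> f ^ k \<in> ideal_power I k"
  by (induction k) (simp_all add: ideal_power_0 mult_in_ideal_power_Suc power_Suc2 del: power_Suc)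

lemma ideal_power_weight_ge:
  assumes add: "\<And>a b. w (a + b) = w a + w b" and I: "I \<subseteq> weight_ge w d"
  shows "ideal_power I k \<subseteq> weight_ge w (k * d)"
proof (induction k)
  case 0
  then show ?case by simp
next
  case (Suc k)
  show ?case
  proof
    fix f assume "f \<in> ideal_power I (Suc k)"
    then have "f \<in> ideal_prod poly_ring (ideal_power I k) I"
      by (simp add: ideal_power_Suc)
    then show "f \<in> weight_ge w (Suc k * d)"
    proof induction
      case (prod f g)
      then have "f * g \<in> weight_ge w (k * d + d)"
        using Suc I by (intro weight_ge_mult[OF add]) auto
      then show ?case
        by (simp add: add.commute)
    next
      case (sum f g)
      then show ?case
        by (simp add: weight_ge_add)
    qed
  qed
qed

text \<open>The exponent vector of the monomial attached to a set of elements of the poset.\<close>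

definition ideal_exponent :: "'p::finite set \<Rightarrow> ('p + 'p) \<Rightarrow>\<^sub>0 nat"
  where "ideal_exponent I = (\<Sum>p\<in>I. Poly_Mapping.single (Inl p) 1)
    + (\<Sum>p\<in>UNIV - I. Poly_Mapping.single (Inr p) 1)"

lemma ideal_monomial_eq_single:
  "ideal_monomial I = Poly_Mapping.single (ideal_exponent I) 1"
  by (simp add: ideal_monomial_def ideal_exponent_def prod_var mult_single)

lemma monom_deg_ideal_exponent: "monom_deg (ideal_exponent (I :: 'p::finite set)) = CARD('p)"
  using card_mono[of UNIV I]
  by (simp add: ideal_exponent_def monom_deg_add weight_sum[of monom_deg] card_Diff_subset)

lemma pair_deg_ideal_exponent: "pair_deg p (ideal_exponent I) = 1"
  by (simp add: ideal_exponent_def pair_deg_add weight_sum[of "pair_deg p"])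

lemma ideal_hibi_ideal:
  "ideal (hibi_ideal :: ('p::{finite,order} + 'p, 'k::field) mpoly set) poly_ring"
  unfolding hibi_ideal_def by (rule ring.genideal_ideal[OF ring_poly_ring]) simp

lemma ideal_monomial_in_hibi_ideal:
  assumes "poset_ideal I"
  shows "ideal_monomial I \<in> (hibi_ideal :: ('p::{finite,order} + 'p, 'k::field) mpoly set)"
  unfolding hibi_ideal_def
  using ring.genideal_self[OF ring_poly_ring,
      of "{ideal_monomial I |I. poset_ideal I} :: ('p + 'p, 'k) mpoly set"] assms
  by auto

lemma hibi_ideal_weight_ge:
  assumes "\<And>a b. w (a + b) = w a + w b" "\<And>I :: 'p set. w (ideal_exponent I) = d"
  shows "(hibi_ideal :: ('p::{finite,order} + 'p, 'k::field) mpoly set) \<subseteq> weight_ge w d"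
  unfolding hibi_ideal_def
  by (rule ring.genideal_minimal[OF ring_poly_ring ideal_weight_ge[OF assms(1)]])
    (auto simp: ideal_monomial_eq_single weight_ge_def assms(2))

lemma hibi_power_colon_prime_degree:
  fixes f :: "('p::{finite,order} + 'p, 'k::field) mpoly"
  assumes f: "f \<in> graded_part d"
    and prime: "primeideal (colon_ideal poly_ring (ideal_power hibi_ideal k) f) poly_ring"
  shows "k * CARD('p) \<le> d + 1"
proof -
  let ?I = "ideal_power (hibi_ideal :: ('p + 'p, 'k) mpoly set) k"
  let ?Q = "colon_ideal poly_ring ?I f"
  have I: "ideal ?I poly_ring"
    by (rule ideal_ideal_power[OF ideal_hibi_ideal])
  have "f \<noteq> 0"
  proof
    assume "f = 0"
    then have "?Q = UNIV"
      using I by (simp add: colon_ideal_poly_ring poly_ideal_iff)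
    then show False
      using primeideal.I_notcarr[OF prime] by simp
  qed
  then obtain m where m: "m \<in> Poly_Mapping.keys f"
    by (metis all_not_in_conv keys_eq_empty)
  have "ideal_monomial {} ^ k \<in> ?I"
    by (intro power_in_ideal_power ideal_monomial_in_hibi_ideal) (simp add: poset_ideal_def)
  then have "f * (\<Prod>i<k. \<Prod>p\<in>UNIV. var (Inr p)) \<in> ?I"
    using I by (simp add: ideal_monomial_def poly_ideal_iff)
  then have "(\<Prod>i<k. \<Prod>p\<in>UNIV. var (Inr p)) \<in> ?Q"
    by (simp add: colon_ideal_poly_ring mult.commute)
  then obtain i where "(\<Prod>p\<in>UNIV. var (Inr p)) \<in> ?Q"
    using prime_ideal_prod[OF prime, of "{..<k}" "\<lambda>i. \<Prod>p\<in>UNIV. var (Inr p)"] by blast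
  then obtain p where "var (Inr p) \<in> ?Q"
    using prime_ideal_prod[OF prime, of UNIV "\<lambda>p. var (Inr p)"] by auto
  then have "f * var (Inr p) \<in> ?I"
    by (simp add: colon_ideal_poly_ring mult.commute)
  also have "?I \<subseteq> weight_ge monom_deg (k * CARD('p))"
    by (intro ideal_power_weight_ge hibi_ideal_weight_ge monom_deg_add monom_deg_ideal_exponent)
  finally have "k * CARD('p) \<le> monom_deg (m + Poly_Mapping.single (Inr p) 1)"
    using keys_mult_monomial[OF m] by (auto simp: weight_ge_def var_def)
  then show ?thesis
    using f m by (simp add: monom_deg_add graded_part_def)
qed

text \<open>For a minimal element \<open>p\<close>, the witness: the monomial of the empty poset ideal to the power
  \<open>j + 1\<close>, with one factor \<open>y\<^sub>p\<close> removed.\<close>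

definition witness_exponent :: "'p::finite \<Rightarrow> nat \<Rightarrow> ('p + 'p) \<Rightarrow>\<^sub>0 nat"
  where "witness_exponent p j =
    (\<Sum>q\<in>UNIV - {p}. Poly_Mapping.single (Inr q) 1) + (\<Sum>i<j. ideal_exponent {})"

lemma monom_deg_witness_exponent:
  "monom_deg (witness_exponent (p :: 'p::finite) j) = Suc j * CARD('p) - 1"
  by (simp add: witness_exponent_def monom_deg_add weight_sum[of monom_deg]
      monom_deg_ideal_exponent card_Diff_singleton)

lemma pair_deg_witness_exponent: "pair_deg p (witness_exponent p j) = j"
  by (simp add: witness_exponent_def pair_deg_add weight_sum[of "pair_deg p"]
      pair_deg_ideal_exponent)

lemma witness_times_y:
  "Poly_Mapping.single (witness_exponent p j) 1 * var (Inr p)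
    = (ideal_monomial {} ^ Suc j :: ('p::{finite,order} + 'p, 'k::field) mpoly)"
proof -
  have "ideal_exponent {} = Poly_Mapping.single (Inr p) 1
      + (\<Sum>q\<in>UNIV - {p}. Poly_Mapping.single (Inr q) (1::nat))"
    by (simp add: ideal_exponent_def sum.remove[of UNIV p])
  then show ?thesis
    by (simp add: ideal_monomial_eq_single monomial_power witness_exponent_def var_def
        mult_single ac_simps)
qed

lemma witness_times_x:
  "Poly_Mapping.single (witness_exponent p j) 1 * var (Inl p)
    = (ideal_monomial {} ^ j * ideal_monomial {p} :: ('p::{finite,order} + 'p, 'k::field) mpoly)"
  by (simp add: ideal_monomial_eq_single monomial_power witness_exponent_def var_def
      mult_single ideal_exponent_def[of "{p}"] ac_simps)

text \<open>The right-hand side is the ideal \<open>(x\<^sub>p, y\<^sub>p)\<close>: a polynomial belongs to it if and only if each of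
  its terms is divisible by one of these two variables.\<close>

lemma hibi_power_colon_witness:
  fixes p :: "'p::{finite,order}"
  assumes minimal: "\<And>q. q \<le> p \<Longrightarrow> q = p"
  shows "colon_ideal poly_ring (ideal_power hibi_ideal (Suc j))
      (Poly_Mapping.single (witness_exponent p j) 1)
    = (weight_ge (pair_deg p) 1 :: ('p + 'p, 'k::field) mpoly set)"
proof -
  let ?I = "ideal_power (hibi_ideal :: ('p + 'p, 'k) mpoly set) (Suc j)"
  let ?f = "Poly_Mapping.single (witness_exponent p j) 1 :: ('p + 'p, 'k) mpoly"
  have I: "ideal ?I poly_ring"
    by (rule ideal_ideal_power[OF ideal_hibi_ideal])
  have empty: "ideal_monomial {} \<in> (hibi_ideal :: ('p + 'p, 'k) mpoly set)"
    by (rule ideal_monomial_in_hibi_ideal) (simp add: poset_ideal_def)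
  have singleton: "ideal_monomial {p} \<in> (hibi_ideal :: ('p + 'p, 'k) mpoly set)"
    by (rule ideal_monomial_in_hibi_ideal) (use minimal in \<open>auto simp: poset_ideal_def\<close>)
  have y: "?f * var (Inr p) \<in> ?I"
    unfolding witness_times_y by (rule power_in_ideal_power[OF empty])
  have x: "?f * var (Inl p) \<in> ?I"
    unfolding witness_times_x
    by (rule mult_in_ideal_power_Suc[OF power_in_ideal_power[OF empty] singleton])
  have var_multiple: "Poly_Mapping.single m c * ?f \<in> ?I"
    if v: "?f * var v \<in> ?I" and m: "0 < Poly_Mapping.lookup m v" for m c v
  proof -
    have "m = (m - Poly_Mapping.single v 1) + Poly_Mapping.single v 1"
      using m by (intro poly_mapping_eqI) (auto simp: lookup_add lookup_minus lookup_single when_def)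
    then have "Poly_Mapping.single m c = Poly_Mapping.single (m - Poly_Mapping.single v 1) c * var v"
      by (simp add: var_def mult_single)
    then have "Poly_Mapping.single m c * ?f
        = Poly_Mapping.single (m - Poly_Mapping.single v 1) c * (?f * var v)"
      by (simp only: ac_simps)
    then show ?thesis
      using v I by (simp only: poly_ideal_iff)
  qed
  have "s * ?f \<in> ?I" if s: "s \<in> weight_ge (pair_deg p) 1" for s
  proof -
    have "Poly_Mapping.single m (Poly_Mapping.lookup s m) * ?f \<in> ?I"
      if "m \<in> Poly_Mapping.keys s" for m
    proof -
      have "1 \<le> pair_deg p m"
        using s that by (simp add: weight_ge_def)
      then consider "0 < Poly_Mapping.lookup m (Inl p)" | "0 < Poly_Mapping.lookup m (Inr p)"
        unfolding pair_deg_def by linarith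
      then show ?thesis
        using var_multiple x y by cases blast+
    qed
    then have "(\<Sum>m\<in>Poly_Mapping.keys s. Poly_Mapping.single m (Poly_Mapping.lookup s m) * ?f) \<in> ?I"
      by (rule poly_ideal_sum[OF I])
    then show ?thesis
      by (simp flip: sum_distrib_right poly_mapping_eq_sum_terms)
  qed
  moreover have "s \<in> weight_ge (pair_deg p) 1" if "s * ?f \<in> ?I" for s
  proof -
    have "?I \<subseteq> weight_ge (pair_deg p) (Suc j * 1)"
      by (intro ideal_power_weight_ge hibi_ideal_weight_ge pair_deg_add pair_deg_ideal_exponent)
    then have "Suc j \<le> pair_deg p (m + witness_exponent p j)" if "m \<in> Poly_Mapping.keys s" for m
      using keys_mult_monomial[OF that] \<open>s * ?f \<in> ?I\<close> by (auto simp: weight_ge_def)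
    then show ?thesis
      by (simp add: weight_ge_def pair_deg_add pair_deg_witness_exponent)
  qed
  ultimately show ?thesis
    by (auto simp: colon_ideal_poly_ring)
qed

theorem theorem5p8:
  fixes k :: nat
  assumes "k \<ge> 1"
  shows "v_number (ideal_power (hibi_ideal :: ('p::{finite,order} + 'p, 'k::field) mpoly set) k)
    = enat (k * CARD('p) - 1)"
proof -
  let ?I = "ideal_power (hibi_ideal :: ('p + 'p, 'k) mpoly set) k"
  let ?D = "{enat d |d. \<exists>f\<in>graded_part d.
    colon_ideal poly_ring ?I f \<in> associated_primes poly_ring ?I}"
  note ass_iff = colon_ideal_in_associated_primes_iff[OF ideal_ideal_power[OF ideal_hibi_ideal]]
  obtain j where j: "k = Suc j"
    using assms by (cases k) auto
  obtain p :: 'p where p: "\<And>q. q \<le> p \<Longrightarrow> q = p"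
    using finite_has_minimal[of "UNIV :: 'p set"] by auto
  define f where "f = (Poly_Mapping.single (witness_exponent p j) 1 :: ('p + 'p, 'k) mpoly)"
  have "colon_ideal poly_ring ?I f = weight_ge (pair_deg p) 1"
    unfolding f_def j by (rule hibi_power_colon_witness) (rule p)
  then have "colon_ideal poly_ring ?I f \<in> associated_primes poly_ring ?I"
    unfolding ass_iff using primeideal_weight_ge_1[of "pair_deg p", OF pair_deg_add] by simp
  moreover have "f \<in> graded_part (k * CARD('p) - 1)"
    by (simp add: graded_part_def f_def j monom_deg_witness_exponent)
  ultimately have "enat (k * CARD('p) - 1) \<in> ?D"
    by blast
  moreover have "enat (k * CARD('p) - 1) \<le> e" if "e \<in> ?D" for e
    using that hibi_power_colon_prime_degree[of _ _ k] by (fastforce simp: ass_iff)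
  ultimately show ?thesis
    unfolding v_number_def by (intro antisym Inf_lower Inf_greatest) auto
qed

end
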